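(* Let $p\geq 2$ be a fixed integer. Then there exists $q_0$ such that for every integer $q\geq q_0$, the chromatic polynomial $\pi(K_{p,q},x)$ of the complete bipartite graph $K_{p,q}$ has a non-real root $z\in\mathbb{C}$ with $\Re(z)>p$.
   Context: For a finite simple graph $G$, the chromatic polynomial $\pi(G,x)$ is the polynomial whose value at each positive integer $x$ is the number of proper colourings of the vertices of $G$ with $x$ colours. $K_{p,q}$ denotes the complete bipartite graph with parts of sizes $p$ and $q$. *)

theory Defs
  imports
    "HOL-Library.FuncSet"
    "HOL-Computational_Algebra.Polynomial"
    "Graph_Theory.Graph_Theory"
    Complex_Main
begin

text \<open>
  A finite simple graph is represented as a symmetric digraph satisfying the locale
  predicate \<^term>\<open>graph\<close>: each edge is a pair of opposite arcs. Colourings are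
  extensional functions, so that a colouring is determined by its values on the vertices
  and the set of colourings can be counted.
\<close>

definition proper_colourings :: "('a, 'b) pre_digraph \<Rightarrow> 'c set \<Rightarrow> ('a \<Rightarrow> 'c) set" where
  "proper_colourings G C =
     {f \<in> verts G \<rightarrow>\<^sub>E C. \<forall>e \<in> arcs G. f (tail G e) \<noteq> f (head G e)}"

definition is_chromatic_poly :: "('a, 'b) pre_digraph \<Rightarrow> complex poly \<Rightarrow> bool" where
  "is_chromatic_poly G P \<longleftrightarrow>
     (\<forall>x::nat. x > 0 \<longrightarrow> poly P (of_nat x) = of_nat (card (proper_colourings G {..<x})))"

text \<open>
  For every finite simple graph the description below is proper, see \<open>chromatic_poly\<close>.
\<close>

definition chromatic_poly :: "('a, 'b) pre_digraph \<Rightarrow> complex poly" where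
  "chromatic_poly G = (THE P. is_chromatic_poly G P)"

lemma is_chromatic_poly_unique:
  assumes "is_chromatic_poly G P" "is_chromatic_poly G Q"
  shows "P = Q"
proof (rule ccontr)
  assume "P \<noteq> Q"
  hence "finite {z. poly (P - Q) z = 0}" by (intro poly_roots_finite) simp
  moreover have "(of_nat :: nat \<Rightarrow> complex) ` {0<..} \<subseteq> {z. poly (P - Q) z = 0}"
    using assms by (auto simp: is_chromatic_poly_def)
  ultimately have "finite ((of_nat :: nat \<Rightarrow> complex) ` {0<..})"
    by (rule rev_finite_subset)
  hence "finite {0::nat<..}"
    by (rule finite_imageD) (simp add: inj_on_def)
  thus False by (simp add: infinite_Ioi)
qed

definition onto_colourings :: "('a, 'b) pre_digraph \<Rightarrow> 'c set \<Rightarrow> ('a \<Rightarrow> 'c) set" where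
  "onto_colourings G S = {f \<in> proper_colourings G S. f ` verts G = S}"

lemma card_onto_colourings_le:
  assumes G: "graph G" and fin: "finite T" and bij: "bij_betw h S T"
  shows "card (onto_colourings G S) \<le> card (onto_colourings G T)"
proof -
  interpret graph G by fact
  have inj: "inj_on h S" and img: "h ` S = T" using bij by (auto simp: bij_betw_def)
  let ?\<Phi> = "\<lambda>f. restrict (h \<circ> f) (verts G)"
  have "finite (verts G \<rightarrow>\<^sub>E T)" using fin by (intro finite_PiE) auto
  hence fin': "finite (onto_colourings G T)"
    by (rule rev_finite_subset) (auto simp: onto_colourings_def proper_colourings_def)
  have "inj_on ?\<Phi> (onto_colourings G S)"
  proof (rule inj_onI)
    fix f g assume f: "f \<in> onto_colourings G S" and g: "g \<in> onto_colourings G S"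
      and eq: "?\<Phi> f = ?\<Phi> g"
    have fE: "f \<in> verts G \<rightarrow>\<^sub>E S" and gE: "g \<in> verts G \<rightarrow>\<^sub>E S"
      using f g by (auto simp: onto_colourings_def proper_colourings_def)
    show "f = g"
    proof (rule PiE_ext[OF fE gE])
      fix v assume v: "v \<in> verts G"
      have "h (f v) = h (g v)" using fun_cong[OF eq, of v] v by simp
      thus "f v = g v" using inj v fE gE by (meson PiE_mem inj_onD)
    qed
  qed
  moreover have "?\<Phi> ` onto_colourings G S \<subseteq> onto_colourings G T"
  proof (rule image_subsetI)
    fix f assume f: "f \<in> onto_colourings G S"
    have fE: "f \<in> verts G \<rightarrow>\<^sub>E S" and fS: "f ` verts G = S"
      and pr: "\<forall>e \<in> arcs G. f (tail G e) \<noteq> f (head G e)"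
      using f by (auto simp: onto_colourings_def proper_colourings_def)
    have "?\<Phi> f ` verts G = h ` (f ` verts G)" by (simp add: image_comp)
    hence im: "?\<Phi> f ` verts G = T" using fS img by simp
    have "?\<Phi> f (tail G e) \<noteq> ?\<Phi> f (head G e)" if e: "e \<in> arcs G" for e
    proof -
      have "tail G e \<in> verts G" "head G e \<in> verts G" using e by auto
      moreover from this have "f (tail G e) \<in> S" "f (head G e) \<in> S" using fS by auto
      ultimately show ?thesis using inj pr e by (auto dest: inj_onD)
    qed
    thus "?\<Phi> f \<in> onto_colourings G T"
      using im by (auto simp: onto_colourings_def proper_colourings_def)
  qed
  ultimately show ?thesis using fin' by (rule card_inj_on_le)
qed

lemma card_onto_colourings_cong:
  assumes G: "graph G" and "finite S" "finite T" "card S = card T"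
  shows "card (onto_colourings G S) = card (onto_colourings G T)"
proof (rule antisym)
  obtain h where h: "bij_betw h S T" using assms by (metis finite_same_card_bij)
  show "card (onto_colourings G S) \<le> card (onto_colourings G T)"
    using card_onto_colourings_le[OF G \<open>finite T\<close> h] .
  show "card (onto_colourings G T) \<le> card (onto_colourings G S)"
    using card_onto_colourings_le[OF G \<open>finite S\<close> bij_betw_inv_into[OF h]] .
qed

lemma card_proper_colourings:
  assumes G: "graph G"
  shows "card (proper_colourings G {..<x}) =
           (\<Sum>k\<le>card (verts G). (x choose k) * card (onto_colourings G {..<k}))"
proof -
  interpret graph G by fact
  let ?s = "\<lambda>k. card (onto_colourings G {..<k::nat})"
  have fin: "finite (onto_colourings G S)" if "finite S" for S :: "nat set"
  proof -
    have "finite (verts G \<rightarrow>\<^sub>E S)" using that by (intro finite_PiE) auto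
    thus ?thesis
      by (rule rev_finite_subset) (auto simp: onto_colourings_def proper_colourings_def)
  qed
  have zero: "?s k = 0" if "k > card (verts G)" for k
  proof -
    have "onto_colourings G {..<k} = {}"
    proof (rule equals0I)
      fix f assume "f \<in> onto_colourings G {..<k}"
      hence "f ` verts G = {..<k}" by (simp add: onto_colourings_def)
      hence "k \<le> card (verts G)" using card_image_le[of "verts G" f] by simp
      thus False using that by simp
    qed
    thus ?thesis by simp
  qed
  have "proper_colourings G {..<x} = (\<Union>S\<in>Pow {..<x}. onto_colourings G S)"
    by (auto simp: onto_colourings_def proper_colourings_def PiE_iff)
  also have "card \<dots> = (\<Sum>S\<in>Pow {..<x}. card (onto_colourings G S))"
  proof (rule card_UN_disjoint)
    show "\<forall>S\<in>Pow {..<x}. finite (onto_colourings G S)"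
      by (auto intro!: fin intro: finite_subset)
  qed (auto simp: onto_colourings_def)
  also have "\<dots> = (\<Sum>S\<in>Pow {..<x}. ?s (card S))"
    by (intro sum.cong refl card_onto_colourings_cong[OF G]) (auto intro: finite_subset)
  also have "\<dots> = (\<Sum>k\<le>x. \<Sum>S\<in>{S\<in>Pow {..<x}. card S = k}. ?s (card S))"
    by (rule sum.group[symmetric]) (auto dest: card_mono[rotated])
  also have "\<dots> = (\<Sum>k\<le>x. (x choose k) * ?s k)"
    using n_subsets[of "{..<x}"] by (intro sum.cong) (auto simp: Pow_def)
  also have "\<dots> = (\<Sum>k\<le>x + card (verts G). (x choose k) * ?s k)"
    by (rule sum.mono_neutral_left) auto
  also have "\<dots> = (\<Sum>k\<le>card (verts G). (x choose k) * ?s k)"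
    by (rule sum.mono_neutral_right) (auto simp: zero)
  finally show ?thesis .
qed

lemma is_chromatic_poly_exists:
  assumes G: "graph G"
  shows "\<exists>P. is_chromatic_poly G P"
proof -
  let ?s = "\<lambda>k. card (onto_colourings G {..<k::nat})"
  define P :: "complex poly" where
    "P = (\<Sum>k\<le>card (verts G). smult (of_nat (?s k) / fact k) (\<Prod>i<k. [:- of_nat i, 1:]))"
  have "poly P (of_nat x) = of_nat (card (proper_colourings G {..<x}))" for x
  proof -
    have "poly P (of_nat x) =
            (\<Sum>k\<le>card (verts G). of_nat (?s k) * (of_nat x gchoose k))"
      by (simp add: P_def poly_sum poly_prod gbinomial_prod_rev lessThan_atLeast0)
    also have "\<dots> = of_nat (card (proper_colourings G {..<x}))"
      by (simp add: card_proper_colourings[OF G] binomial_gbinomial mult.commute)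
    finally show ?thesis .
  qed
  thus ?thesis unfolding is_chromatic_poly_def by blast
qed

lemma chromatic_poly:
  assumes "graph G"
  shows "is_chromatic_poly G (chromatic_poly G)"
  unfolding chromatic_poly_def
  by (rule theI') (use is_chromatic_poly_exists[OF assms] is_chromatic_poly_unique in blast)

text \<open>Over an infinite vertex type all the complete bipartite graphs are present.\<close>

lemma complete_bipartite_digraph_exists:
  "\<exists>G :: (nat, nat \<times> nat) pre_digraph. complete_bipartite_digraph p q G"
proof -
  let ?U = "{..<p}" and ?V = "{p..<p + q}"
  let ?G = "\<lparr>pverts = ?U \<union> ?V, parcs = ?U \<times> ?V \<union> ?V \<times> ?U\<rparr>"
  have "?U \<inter> ?V = {}" "card ?U = p" "card ?V = q" by auto
  hence "complete_bipartite_digraph p q (with_proj ?G)"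
    unfolding complete_bipartite_digraph_pair_def
    by (intro conjI exI[of _ ?U] exI[of _ ?V]) simp_all
  thus ?thesis by blast
qed

end

theory Submission
  imports
    Defs
    "HOL-Computational_Algebra.Fundamental_Theorem_Algebra"
    "HOL-Combinatorics.Stirling"
    "HOL-Complex_Analysis.Complex_Analysis"
    "HOL-Real_Asymp.Real_Asymp"
begin

text \<open>
  With Stirling numbers of the second kind,
  \<open>\<pi>(K\<^bsub>p,q\<^esub>, x) = (\<Sum>k\<le>p. S(p,k) x(x - 1)\<cdots>(x - k + 1) (x - k)\<^sup>q)\<close>.
  Substitute \<open>x = q / w\<close>, where \<open>w = L - ln L + z\<close> and \<open>L = ln q\<close>. Then \<open>w\<^sup>2 / q \<rightarrow> 0\<close>, so
  \<open>(1 - k w / q)\<^sup>q\<close> behaves like \<open>exp (- k w)\<close>, while \<open>(w / q) exp w = (w / L) exp z \<rightarrow> exp z\<close>.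
  After multiplication by \<open>(w / q)\<^bsup>p+q\<^esup> exp (p w)\<close> the polynomial therefore converges, uniformly for
  bounded \<open>z\<close>, to \<open>\<Sum>k\<le>p. S(p,k) exp z\<^bsup>p-k\<^esup>\<close>. This is a polynomial in \<open>exp z\<close> of degree
  \<open>p - 1 > 0\<close> with constant term 1, so it vanishes at some \<open>z\<close>, and the branch of the logarithm can be
  chosen such that \<open>Im z > 0\<close>. By Hurwitz's theorem nearby zeros exist for large \<open>q\<close>; the corresponding
  \<open>x = q / w\<close> is non-real because \<open>Im w = Im z > 0\<close>, and \<open>Re x\<close> grows like \<open>q / ln q\<close>.
\<close>

section \<open>The chromatic polynomial of a complete bipartite graph\<close>

lemma sum_PiE_insert:
  assumes "u \<notin> U"
  shows "(\<Sum>f\<in>insert u U \<rightarrow>\<^sub>E X. F f) = (\<Sum>f\<in>U \<rightarrow>\<^sub>E X. \<Sum>c\<in>X. F (f(u := c)))"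
proof -
  have "(\<Sum>f\<in>insert u U \<rightarrow>\<^sub>E X. F f) = (\<Sum>(c, f)\<in>X \<times> (U \<rightarrow>\<^sub>E X). F (f(u := c)))"
    unfolding PiE_insert_eq
    by (subst sum.reindex) (use inj_combinator [OF assms] in \<open>auto simp: case_prod_unfold\<close>)
  also have "\<dots> = (\<Sum>c\<in>X. \<Sum>f\<in>U \<rightarrow>\<^sub>E X. F (f(u := c)))"
    by (rule sum.cartesian_product [symmetric])
  finally show ?thesis
    by (simp add: sum.swap [of _ X])
qed

text \<open>This is the recurrence S(n+1,k+1) = (k+1) S(n,k+1) + S(n,k), summed against
  \<open>g\<close>. It serves the induction step of the next lemma.\<close>

lemma sum_Stirling_Suc:
  fixes g :: "nat \<Rightarrow> 'a :: comm_ring_1"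
  shows "(\<Sum>k\<le>n. of_nat (Stirling n k) * (of_nat k * g k + g (Suc k))) =
         (\<Sum>k\<le>Suc n. of_nat (Stirling (Suc n) k) * g k)"
proof -
  have "(\<Sum>k\<le>Suc n. of_nat (Stirling (Suc n) k) * g k) =
        (\<Sum>k\<le>n. of_nat (Suc k * Stirling n (Suc k) + Stirling n k) * g (Suc k))"
    by (simp only: sum.atMost_Suc_shift) simp
  also have "\<dots> = (\<Sum>k\<le>n. of_nat (Stirling n (Suc k)) * (of_nat (Suc k) * g (Suc k))) +
                   (\<Sum>k\<le>n. of_nat (Stirling n k) * g (Suc k))"
    by (simp add: sum.distrib [symmetric] algebra_simps)
  also have "(\<Sum>k\<le>n. of_nat (Stirling n (Suc k)) * (of_nat (Suc k) * g (Suc k))) =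
             (\<Sum>k\<le>Suc n. of_nat (Stirling n k) * (of_nat k * g k))"
    by (simp only: sum.atMost_Suc_shift) simp
  also have "\<dots> = (\<Sum>k\<le>n. of_nat (Stirling n k) * (of_nat k * g k))"
    by simp
  finally show ?thesis
    by (simp add: sum.distrib [symmetric] algebra_simps)
qed

text \<open>A map with an image of size k is a partition of \<open>U\<close> into k fibres together
  with an injective choice of values, which gives S(|U|,k) x(x-1)...(x-k+1) maps. Taking
  \<open>h\<close> with values in a ring makes the falling factorial vanish for k > |X|, and a
  general \<open>h\<close> is what the induction on \<open>U\<close> needs.\<close>

lemma sum_card_image_Stirling:
  fixes h :: "nat \<Rightarrow> 'a :: comm_ring_1"
  assumes "finite U" "finite X"
  shows "(\<Sum>f\<in>U \<rightarrow>\<^sub>E X. h (card (f ` U))) =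
         (\<Sum>k\<le>card U. of_nat (Stirling (card U) k) * ((\<Prod>j<k. of_nat (card X) - of_nat j) * h k))"
  using assms(1)
proof (induction U arbitrary: h)
  case empty
  then show ?case by simp
next
  case (insert u U)
  define x where "x = (of_nat (card X) :: 'a)"
  have "(\<Sum>f\<in>insert u U \<rightarrow>\<^sub>E X. h (card (f ` insert u U))) =
        (\<Sum>f\<in>U \<rightarrow>\<^sub>E X. \<Sum>c\<in>X. h (card (insert c (f ` U))))"
  proof -
    have "f(u := c) ` insert u U = insert c (f ` U)" for f :: "'b \<Rightarrow> 'c" and c
      using insert.hyps by (auto simp: image_iff)
    thus ?thesis using insert.hyps by (simp add: sum_PiE_insert)
  qed
  \<comment> \<open>The new value \<open>c\<close> either lies in the old image, whose size then
    stays, or is one of the remaining elements of \<open>X\<close> and enlarges it by one.\<close>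
  also have "\<dots> = (\<Sum>f\<in>U \<rightarrow>\<^sub>E X. of_nat (card (f ` U)) * h (card (f ` U)) +
                      (x - of_nat (card (f ` U))) * h (Suc (card (f ` U))))"
  proof (rule sum.cong [OF refl])
    fix f assume f: "f \<in> U \<rightarrow>\<^sub>E X"
    let ?I = "f ` U"
    have I: "?I \<subseteq> X" "finite ?I" using f insert.hyps by auto
    have "(\<Sum>c\<in>X. h (card (insert c ?I))) =
          (\<Sum>c\<in>X - ?I. h (card (insert c ?I))) + (\<Sum>c\<in>?I. h (card (insert c ?I)))"
      by (rule sum.subset_diff [OF I(1) assms(2)])
    also have "(\<Sum>c\<in>?I. h (card (insert c ?I))) = of_nat (card ?I) * h (card ?I)"
      by (simp add: insert_absorb)
    also have "(\<Sum>c\<in>X - ?I. h (card (insert c ?I))) = of_nat (card (X - ?I)) * h (Suc (card ?I))"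
      using I by simp
    also have "of_nat (card (X - ?I)) = x - of_nat (card ?I)"
      unfolding x_def using I assms(2) by (simp add: card_Diff_subset card_mono of_nat_diff)
    finally show "(\<Sum>c\<in>X. h (card (insert c ?I))) =
        of_nat (card ?I) * h (card ?I) + (x - of_nat (card ?I)) * h (Suc (card ?I))"
      by (simp add: add.commute)
  qed
  \<comment> \<open>The induction hypothesis is applied to k \<mapsto>
    \<open>of_nat k * h k + (x - of_nat k) * h (Suc k)\<close>. The factor
    \<open>x - of_nat k\<close> then extends the falling factorial by one step.\<close>
  also have "\<dots> = (\<Sum>k\<le>card U. of_nat (Stirling (card U) k) *
                     ((\<Prod>j<k. x - of_nat j) * (of_nat k * h k + (x - of_nat k) * h (Suc k))))"
    unfolding x_def by (rule insert.IH)
  also have "\<dots> = (\<Sum>k\<le>card U. of_nat (Stirling (card U) k) *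
                     (of_nat k * ((\<Prod>j<k. x - of_nat j) * h k) +
                      (\<Prod>j<Suc k. x - of_nat j) * h (Suc k)))"
    by (intro sum.cong refl) (simp add: algebra_simps)
  also have "\<dots> = (\<Sum>k\<le>Suc (card U). of_nat (Stirling (Suc (card U)) k) *
                     ((\<Prod>j<k. x - of_nat j) * h k))"
    by (rule sum_Stirling_Suc)
  finally show ?case
    using insert.hyps by (simp add: x_def)
qed

lemma card_proper_colourings_bipartite:
  assumes "graph G" "verts G = U \<union> V" "U \<inter> V = {}" "arcs_ends G = U \<times> V \<union> V \<times> U"
    and "finite X"
  shows "card (proper_colourings G X) = (\<Sum>f\<in>U \<rightarrow>\<^sub>E X. (card X - card (f ` U)) ^ card V)"
proof -
  interpret graph G by fact
  have fin: "finite U" "finite V"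
    using finite_verts assms(2) by auto
  have proper: "(\<forall>e\<in>arcs G. f (tail G e) \<noteq> f (head G e)) \<longleftrightarrow> (\<forall>u\<in>U. \<forall>v\<in>V. f u \<noteq> f v)"
    for f :: "'a \<Rightarrow> 'c"
  proof -
    have "(\<forall>e\<in>arcs G. f (tail G e) \<noteq> f (head G e)) \<longleftrightarrow> (\<forall>(a, b)\<in>arcs_ends G. f a \<noteq> f b)"
      by (auto simp: arcs_ends_def arc_to_ends_def)
    also have "\<dots> \<longleftrightarrow> (\<forall>u\<in>U. \<forall>v\<in>V. f u \<noteq> f v)"
      unfolding assms(4) by (auto dest: not_sym)
    finally show ?thesis .
  qed
  have "bij_betw (\<lambda>f. (restrict f U, restrict f V)) (proper_colourings G X)
          (SIGMA f:U \<rightarrow>\<^sub>E X. V \<rightarrow>\<^sub>E X - f ` U)"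
  \<comment> \<open>The inverse glues the two colourings. Off \<open>U\<close> it follows
    \<open>g\<close>, which is \<open>undefined\<close> outside \<open>V\<close>, so the result is
    again extensional.\<close>
  proof (rule bij_betw_byWitness [where f' = "\<lambda>(f, g) x. if x \<in> U then f x else g x"])
    have "(\<lambda>(f, g) x. if x \<in> U then f x else g x) (restrict f U, restrict f V) = f"
      if "f \<in> U \<union> V \<rightarrow>\<^sub>E X" for f
      using PiE_arb [OF that] by (auto simp: fun_eq_iff)
    thus "\<forall>f\<in>proper_colourings G X.
            (\<lambda>(f, g) x. if x \<in> U then f x else g x) (restrict f U, restrict f V) = f"
      unfolding proper_colourings_def assms(2) by blast
    show "\<forall>fg\<in>SIGMA f:U \<rightarrow>\<^sub>E X. V \<rightarrow>\<^sub>E X - f ` U.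
            (\<lambda>f. (restrict f U, restrict f V)) ((\<lambda>(f, g) x. if x \<in> U then f x else g x) fg) = fg"
      using assms(3) by (auto simp: fun_eq_iff PiE_iff extensional_def)
    show "(\<lambda>f. (restrict f U, restrict f V)) ` proper_colourings G X
            \<subseteq> (SIGMA f:U \<rightarrow>\<^sub>E X. V \<rightarrow>\<^sub>E X - f ` U)"
      unfolding proper_colourings_def proper assms(2) by (fastforce simp: PiE_iff)
    have "(\<lambda>x. if x \<in> U then f x else g x) \<in> proper_colourings G X"
      if f: "f \<in> U \<rightarrow>\<^sub>E X" and g: "g \<in> V \<rightarrow>\<^sub>E X - f ` U" for f g
    proof -
      have "(\<lambda>x. if x \<in> U then f x else g x) \<in> U \<union> V \<rightarrow>\<^sub>E X"
      proof (rule PiE_I)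
        fix x assume "x \<in> U \<union> V"
        thus "(if x \<in> U then f x else g x) \<in> X"
          using PiE_mem [OF f, of x] PiE_mem [OF g, of x] by (cases "x \<in> U") simp_all
      next
        fix x assume "x \<notin> U \<union> V"
        thus "(if x \<in> U then f x else g x) = undefined"
          using PiE_arb [OF g, of x] by simp
      qed
      moreover have "f u \<noteq> g v" if "u \<in> U" "v \<in> V" for u v
        using PiE_mem [OF g \<open>v \<in> V\<close>] \<open>u \<in> U\<close> by (metis Diff_iff imageI)
      moreover have "v \<notin> U" if "v \<in> V" for v
        using assms(3) that by auto
      ultimately show ?thesis
        unfolding proper_colourings_def proper assms(2) by simp
    qed
    thus "(\<lambda>(f, g) x. if x \<in> U then f x else g x) ` (SIGMA f:U \<rightarrow>\<^sub>E X. V \<rightarrow>\<^sub>E X - f ` U)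
            \<subseteq> proper_colourings G X"
      by (intro image_subsetI, elim SigmaE) (simp only: prod.case)
  qed
  hence "card (proper_colourings G X) = card (SIGMA f:U \<rightarrow>\<^sub>E X. V \<rightarrow>\<^sub>E X - f ` U)"
    by (rule bij_betw_same_card)
  also have "\<dots> = (\<Sum>f\<in>U \<rightarrow>\<^sub>E X. card (V \<rightarrow>\<^sub>E X - f ` U))"
    using fin assms(5) by (intro card_SigmaI finite_PiE ballI) auto
  also have "\<dots> = (\<Sum>f\<in>U \<rightarrow>\<^sub>E X. (card X - card (f ` U)) ^ card V)"
  proof (rule sum.cong [OF refl])
    fix f assume "f \<in> U \<rightarrow>\<^sub>E X"
    hence "f ` U \<subseteq> X" by auto
    thus "card (V \<rightarrow>\<^sub>E X - f ` U) = (card X - card (f ` U)) ^ card V"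
      using fin assms(5) by (simp add: card_PiE card_Diff_subset finite_subset)
  qed
  finally show ?thesis .
qed

text \<open>The colourings of \<open>U\<close> are grouped by the number k of colours used. This
  gives the formula at natural numbers, and uniqueness of the chromatic polynomial extends it to
  complex arguments.\<close>

lemma poly_chromatic_poly_complete_bipartite:
  assumes "complete_bipartite_digraph p q G"
  shows "poly (chromatic_poly G) x =
           (\<Sum>k\<le>p. of_nat (Stirling p k) * ((\<Prod>j<k. x - of_nat j) * (x - of_nat k) ^ q))"
proof -
  obtain U V where G: "graph G" and UV: "verts G = U \<union> V" "U \<inter> V = {}"
      "arcs_ends G = U \<times> V \<union> V \<times> U" and card: "card U = p" "card V = q"
    using assms unfolding complete_bipartite_digraph_def by blast
  interpret graph G by fact
  have fin: "finite U" using finite_verts UV by auto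
  define P :: "complex poly" where
    "P = (\<Sum>k\<le>p. smult (of_nat (Stirling p k))
            ((\<Prod>j<k. [:- of_nat j, 1:]) * [:- of_nat k, 1:] ^ q))"
  have P: "poly P x =
      (\<Sum>k\<le>p. of_nat (Stirling p k) * ((\<Prod>j<k. x - of_nat j) * (x - of_nat k) ^ q))" for x
    by (simp add: P_def poly_sum poly_prod)
  have "poly P (of_nat n) = of_nat (card (proper_colourings G {..<n}))" for n
  proof -
    have "of_nat (card (proper_colourings G {..<n})) =
            (\<Sum>f\<in>U \<rightarrow>\<^sub>E {..<n}. (of_nat n - of_nat (card (f ` U))) ^ q :: complex)"
      unfolding card_proper_colourings_bipartite [OF G UV finite_lessThan] of_nat_sum
    proof (rule sum.cong [OF refl])
      fix f assume "f \<in> U \<rightarrow>\<^sub>E {..<n}"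
      \<comment> \<open>This bound makes the truncated subtraction of naturals agree with the
        complex one.\<close>
      hence "card (f ` U) \<le> n"
        using card_mono [of "{..<n}" "f ` U"] by auto
      thus "of_nat ((card {..<n} - card (f ` U)) ^ card V) =
              (of_nat n - of_nat (card (f ` U)) :: complex) ^ q"
        by (simp add: card)
    qed
    also have "\<dots> = poly P (of_nat n)"
      using sum_card_image_Stirling [OF fin finite_lessThan [of n],
          where h = "\<lambda>k. (of_nat n - of_nat k :: complex) ^ q"]
      by (simp add: P card)
    finally show ?thesis ..
  qed
  hence "is_chromatic_poly G P"
    by (simp add: is_chromatic_poly_def)
  hence "chromatic_poly G = P"
    using chromatic_poly [OF G] is_chromatic_poly_unique by blast
  thus ?thesis by (simp add: P)
qed

section \<open>Uniform asymptotics\<close>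

text \<open>A product with a principal filter encodes uniformity in the second variable, so that
  uniform limits can be computed with the ordinary rules for \<open>tendsto\<close>.\<close>

lemma eventually_prod_principal:
  "(\<forall>\<^sub>F (x, y) in F \<times>\<^sub>F principal S. P x y) \<longleftrightarrow> (\<forall>\<^sub>F x in F. \<forall>y\<in>S. P x y)"
proof
  assume "\<forall>\<^sub>F (x, y) in F \<times>\<^sub>F principal S. P x y"
  from eventually_eventually_prod_filter1 [OF this] show "\<forall>\<^sub>F x in F. \<forall>y\<in>S. P x y"
    by (simp add: eventually_principal)
next
  assume "\<forall>\<^sub>F x in F. \<forall>y\<in>S. P x y"
  thus "\<forall>\<^sub>F (x, y) in F \<times>\<^sub>F principal S. P x y"
    unfolding eventually_prod_filter
    by (intro exI [of _ "\<lambda>x. \<forall>y\<in>S. P x y"] exI [of _ "\<lambda>y. y \<in> S"]) (auto simp: eventually_principal)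
qed

lemma eventually_snd_in_prod_principal: "\<forall>\<^sub>F i in F \<times>\<^sub>F principal S. snd i \<in> S"
  using eventually_prod_principal [of "\<lambda>x y. y \<in> S" F S] by (simp add: case_prod_unfold)

lemma uniform_limit_if_tendsto_prod:
  fixes f :: "'i \<Rightarrow> 'a \<Rightarrow> 'b :: real_normed_vector"
  assumes "((\<lambda>(n, z). f n z - g z) \<longlongrightarrow> 0) (F \<times>\<^sub>F principal S)"
  shows "uniform_limit S f g F"
proof (rule uniform_limitI)
  fix e :: real assume "e > 0"
  with assms have "\<forall>\<^sub>F (n, z) in F \<times>\<^sub>F principal S. dist (f n z) (g z) < e"
    by (auto dest!: tendstoD simp: case_prod_unfold dist_norm)
  thus "\<forall>\<^sub>F n in F. \<forall>z\<in>S. dist (f n z) (g z) < e"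
    by (simp add: eventually_prod_principal)
qed

text \<open>Since Ln (1 + v) = v + O(v^2), the logarithm of the product is O(N v^2). The quantity N
  v itself may be unbounded.\<close>

lemma one_plus_power_tendsto_exp:
  fixes v :: "'i \<Rightarrow> complex" and N :: "'i \<Rightarrow> nat"
  assumes v: "(v \<longlongrightarrow> 0) F" and Nv2: "((\<lambda>i. of_nat (N i) * v i ^ 2) \<longlongrightarrow> 0) F"
  shows "((\<lambda>i. (1 + v i) ^ N i * exp (- of_nat (N i) * v i)) \<longlongrightarrow> 1) F"
proof -
  \<comment> \<open>The bound 1/2 keeps \<open>1 + v i\<close> away from 0 and yields the factor 2
    in the error estimate below.\<close>
  have small: "\<forall>\<^sub>F i in F. norm (v i) < 1/2"
    using tendstoD [OF v, of "1/2"] by simp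
  have "((\<lambda>i. of_nat (N i) * (Ln (1 + v i) - v i)) \<longlongrightarrow> 0) F"
  proof (rule Lim_null_comparison)
    show "((\<lambda>i. 2 * norm (of_nat (N i) * v i ^ 2)) \<longlongrightarrow> 0) F"
      using tendsto_mult_left [OF tendsto_norm_zero [OF Nv2], of 2] by simp
    show "\<forall>\<^sub>F i in F. norm (of_nat (N i) * (Ln (1 + v i) - v i)) \<le> 2 * norm (of_nat (N i) * v i ^ 2)"
      using small
    proof eventually_elim
      case (elim i)
      have "norm (Ln (1 + v i) - v i) \<le> norm (v i) ^ 2 / (1 - norm (v i))"
        using elim by (intro Ln_approx_linear) auto
      also have "\<dots> \<le> norm (v i) ^ 2 / (1/2)"
        using elim by (intro divide_left_mono) auto
      finally have "real (N i) * norm (Ln (1 + v i) - v i) \<le> real (N i) * (2 * norm (v i) ^ 2)"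
        by (intro mult_left_mono) auto
      thus ?case by (simp add: norm_mult norm_power)
    qed
  qed
  hence "((\<lambda>i. exp (of_nat (N i) * (Ln (1 + v i) - v i))) \<longlongrightarrow> 1) F"
    using tendsto_exp by fastforce
  moreover have "\<forall>\<^sub>F i in F. exp (of_nat (N i) * (Ln (1 + v i) - v i)) =
                   (1 + v i) ^ N i * exp (- of_nat (N i) * v i)"
    using small
  proof eventually_elim
    case (elim i)
    hence "1 + v i \<noteq> 0"
      by (metis add_eq_0_iff norm_minus_cancel norm_one less_divide_eq_1_pos not_less_iff_gr_or_eq
          one_less_numeral_iff semiring_norm(76) zero_less_numeral)
    thus ?case
      by (simp add: right_diff_distrib exp_diff exp_of_nat_mult exp_minus divide_inverse)
  qed
  ultimately show ?thesis
    by (rule Lim_transform_eventually)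
qed

definition scaled_arg :: "nat \<Rightarrow> complex \<Rightarrow> complex" where
  "scaled_arg q z = of_real (ln (real q) - ln (ln (real q))) + z"

text \<open>Both \<open>ln (ln q)\<close> and the bounded \<open>z\<close> are negligible against
  \<open>ln q\<close>.\<close>

lemma scaled_arg_div_ln_tendsto:
  assumes "bounded S"
  shows "((\<lambda>(q, z). scaled_arg q z / of_real (ln (real q))) \<longlongrightarrow> 1) (sequentially \<times>\<^sub>F principal S)"
    (is "(_ \<longlongrightarrow> _) ?G")
proof -
  obtain B where B: "\<And>z. z \<in> S \<Longrightarrow> norm z \<le> B"
    using assms bounded_iff by blast
  have fst: "filterlim fst sequentially ?G"
    by (rule filterlim_fst)
  have snd: "\<forall>\<^sub>F i in ?G. snd i \<in> S"
    by (rule eventually_snd_in_prod_principal)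
  have "((\<lambda>q. (ln (real q) - ln (ln (real q))) / ln (real q)) \<longlongrightarrow> 1) sequentially"
    by real_asymp
  from tendsto_of_real [OF this, where 'a = complex]
  have 1: "((\<lambda>i. of_real ((ln (real (fst i)) - ln (ln (real (fst i)))) / ln (real (fst i)))) \<longlongrightarrow> (1::complex)) ?G"
    by (intro filterlim_compose [OF _ fst]) simp
  have "((\<lambda>q. B / ln (real q)) \<longlongrightarrow> 0) sequentially"
    by real_asymp
  hence B0: "((\<lambda>i. B / ln (real (fst i))) \<longlongrightarrow> 0) ?G"
    by (rule filterlim_compose [OF _ fst])
  have "\<forall>\<^sub>F q in sequentially. ln (real q) > 0"
    by real_asymp
  hence pos: "\<forall>\<^sub>F i in ?G. ln (real (fst i)) > 0"
    by (rule eventually_compose_filterlim [OF _ fst])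
  have 2: "((\<lambda>i. snd i / of_real (ln (real (fst i)))) \<longlongrightarrow> 0) ?G"
    by (rule Lim_null_comparison [OF _ B0], use pos snd in eventually_elim)
       (auto simp: norm_divide intro!: divide_right_mono B)
  show ?thesis
    using tendsto_add [OF 1 2] by (simp add: scaled_arg_def case_prod_unfold add_divide_distrib)
qed

text \<open>With \<open>v = w / q = 1 / x\<close> this is v^(p+q) exp(p w) \<pi>(K_{p,q}, 1/v), the
  multiplier being distributed so that each factor converges by itself. In this form it is visibly
  entire in \<open>z\<close>.\<close>

definition rescaled_chromatic :: "nat \<Rightarrow> nat \<Rightarrow> complex \<Rightarrow> complex" where
  "rescaled_chromatic p q z = (let w = scaled_arg q z; v = w / of_nat q in
     \<Sum>k\<le>p. of_nat (Stirling p k) * ((v * exp w) ^ (p - k) *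
       ((\<Prod>j<k. 1 - of_nat j * v) * ((1 - of_nat k * v) ^ q * exp (of_nat k * w)))))"

text \<open>The Touchard polynomial with reversed coefficients, evaluated at
  \<open>exp z\<close>.\<close>

definition limit_chromatic :: "nat \<Rightarrow> complex \<Rightarrow> complex" where
  "limit_chromatic p z = (\<Sum>k\<le>p. of_nat (Stirling p k) * exp z ^ (p - k))"

text \<open>With \<open>r = w / ln q\<close> one has \<open>v * exp w = r * exp z\<close> for large
  q. The k-th summand is thus its claimed limit times a factor \<open>D k\<close> tending to 1 along
  the product filter.\<close>

lemma rescaled_chromatic_uniform_limit:
  assumes S: "bounded S"
  shows "uniform_limit S (rescaled_chromatic p) (limit_chromatic p) sequentially"
proof (rule uniform_limit_if_tendsto_prod)
  let ?G = "sequentially \<times>\<^sub>F principal S"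
  define r where "r = (\<lambda>i. scaled_arg (fst i) (snd i) / of_real (ln (real (fst i))))"
  define v where "v = (\<lambda>i. scaled_arg (fst i) (snd i) / of_nat (fst i))"
  have fst: "filterlim fst sequentially ?G"
    by (rule filterlim_fst)
  have snd: "\<forall>\<^sub>F i in ?G. snd i \<in> S"
    by (rule eventually_snd_in_prod_principal)
  have "\<forall>\<^sub>F q in sequentially. ln (real q) > 0"
    by real_asymp
  hence pos: "\<forall>\<^sub>F i in ?G. ln (real (fst i)) > 0"
    by (rule eventually_compose_filterlim [OF _ fst])
  have r: "(r \<longlongrightarrow> 1) ?G"
    using scaled_arg_div_ln_tendsto [OF S] by (simp add: r_def case_prod_unfold)
  have lift: "((\<lambda>i. of_real (f (fst i)) :: complex) \<longlongrightarrow> 0) ?G" if "f \<longlonglongrightarrow> 0" for f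
    using tendsto_of_real [OF filterlim_compose [OF that fst], where 'a = complex] by simp
  have "((\<lambda>i. r i * of_real (ln (real (fst i)) / real (fst i))) \<longlongrightarrow> 1 * 0) ?G"
    by (intro tendsto_mult r lift) real_asymp
  moreover have "\<forall>\<^sub>F i in ?G. r i * of_real (ln (real (fst i)) / real (fst i)) = v i"
    using pos by eventually_elim (simp add: r_def v_def field_simps)
  ultimately have v: "(v \<longlongrightarrow> 0) ?G"
    by (auto intro: Lim_transform_eventually)
  \<comment> \<open>The smallness of q v^2, required for the exponential approximation, comes from
    (ln q)^2 / q \<rightarrow> 0.\<close>
  have "((\<lambda>i. r i ^ 2 * of_real (ln (real (fst i)) ^ 2 / real (fst i))) \<longlongrightarrow> 1 ^ 2 * 0) ?G"
    by (intro tendsto_mult tendsto_power r lift) real_asymp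
  moreover have "\<forall>\<^sub>F i in ?G. r i ^ 2 * of_real (ln (real (fst i)) ^ 2 / real (fst i)) =
                   of_nat (fst i) * v i ^ 2"
    using pos by eventually_elim (simp add: r_def v_def field_simps power2_eq_square)
  ultimately have qv2: "((\<lambda>i. of_nat (fst i) * v i ^ 2) \<longlongrightarrow> 0) ?G"
    by (auto intro: Lim_transform_eventually)

  define E where "E = (\<lambda>k i. (1 - of_nat k * v i) ^ fst i * exp (of_nat k * scaled_arg (fst i) (snd i)))"
  have E: "(E k \<longlongrightarrow> 1) ?G" for k
  proof (rule Lim_transform_eventually)
    have kv: "((\<lambda>i. - of_nat k * v i) \<longlongrightarrow> 0) ?G"
      using tendsto_mult_left [OF v, of "- of_nat k"] by simp
    have "((\<lambda>i. of_nat k ^ 2 * (of_nat (fst i) * v i ^ 2)) \<longlongrightarrow> 0) ?G"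
      using tendsto_mult_left [OF qv2, of "of_nat k ^ 2"] by simp
    hence kv2: "((\<lambda>i. of_nat (fst i) * (- of_nat k * v i) ^ 2) \<longlongrightarrow> 0) ?G"
      by (simp add: power_mult_distrib mult_ac)
    show "((\<lambda>i. (1 + - of_nat k * v i) ^ fst i * exp (- of_nat (fst i) * (- of_nat k * v i))) \<longlongrightarrow> 1) ?G"
      by (rule one_plus_power_tendsto_exp [OF kv kv2])
    show "\<forall>\<^sub>F i in ?G. (1 + - of_nat k * v i) ^ fst i * exp (- of_nat (fst i) * (- of_nat k * v i)) = E k i"
      using pos
    proof eventually_elim
      case (elim i)
      \<comment> \<open>Nonzero q gives q (k v) = k w, which turns the exponent into that of
        \<open>E k\<close>.\<close>
      hence "fst i \<noteq> 0" by (intro notI) simp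
      thus ?case by (simp add: E_def v_def)
    qed
  qed
  define D where "D = (\<lambda>k i. r i ^ (p - k) * ((\<Prod>j<k. 1 - of_nat j * v i) * E k i))"
  have "(D k \<longlongrightarrow> 1 ^ (p - k) * ((\<Prod>j<k. 1 - of_nat j * 0) * 1)) ?G" for k
    unfolding D_def by (intro tendsto_intros r v E)
  hence D: "((\<lambda>i. D k i - 1) \<longlongrightarrow> 0) ?G" for k
    by (simp add: LIM_zero_iff)

  \<comment> \<open>Since \<open>z\<close> varies with the filter, \<open>exp z\<close> need not
    converge; the bound \<open>exp B\<close> on its modulus suffices because
    \<open>D k i - 1\<close> tends to 0.\<close>
  obtain B where B: "\<And>z. z \<in> S \<Longrightarrow> norm z \<le> B"
    using S bounded_iff by blast
  have "((\<lambda>i. of_nat (Stirling p k) * (exp (snd i) ^ (p - k) * (D k i - 1))) \<longlongrightarrow> 0) ?G" for k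
  proof -
    have "((\<lambda>i. exp (snd i) ^ (p - k) * (D k i - 1)) \<longlongrightarrow> 0) ?G"
    proof (rule Lim_null_comparison)
      show "((\<lambda>i. exp B ^ (p - k) * norm (D k i - 1)) \<longlongrightarrow> 0) ?G"
        using tendsto_mult_left [OF tendsto_norm_zero [OF D [of k]], of "exp B ^ (p - k)"] by simp
      show "\<forall>\<^sub>F i in ?G. norm (exp (snd i) ^ (p - k) * (D k i - 1)) \<le> exp B ^ (p - k) * norm (D k i - 1)"
        using snd
      proof eventually_elim
        case (elim i)
        have "Re (snd i) \<le> B"
          using B [OF elim] complex_Re_le_cmod order_trans by blast
        thus ?case
          by (auto simp: norm_mult norm_power intro!: mult_right_mono power_mono)
      qed
    qed
    from tendsto_mult_left [OF this] show ?thesis by simp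
  qed
  hence "((\<lambda>i. \<Sum>k\<le>p. of_nat (Stirling p k) * (exp (snd i) ^ (p - k) * (D k i - 1))) \<longlongrightarrow> 0) ?G"
    by (rule tendsto_null_sum)
  moreover have "\<forall>\<^sub>F i in ?G. (\<Sum>k\<le>p. of_nat (Stirling p k) * (exp (snd i) ^ (p - k) * (D k i - 1))) =
                   rescaled_chromatic p (fst i) (snd i) - limit_chromatic p (snd i)"
    using pos
  proof eventually_elim
    case (elim i)
    let ?w = "scaled_arg (fst i) (snd i)"
    have "real (fst i) > 0" using elim by (cases "fst i = 0") auto
    hence "exp (ln (real (fst i)) - ln (ln (real (fst i)))) = real (fst i) / ln (real (fst i))"
      using elim by (simp add: exp_diff)
    hence "exp ?w = of_real (real (fst i) / ln (real (fst i))) * exp (snd i)"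
      unfolding scaled_arg_def exp_add exp_of_real by simp
    hence "v i * exp ?w = r i * exp (snd i)"
      using elim \<open>real (fst i) > 0\<close> by (simp add: v_def r_def)
    moreover have vi: "?w / of_nat (fst i) = v i" by (simp add: v_def)
    ultimately have "rescaled_chromatic p (fst i) (snd i) =
             (\<Sum>k\<le>p. of_nat (Stirling p k) * (exp (snd i) ^ (p - k) * D k i))"
      unfolding rescaled_chromatic_def Let_def D_def E_def
      by (simp only: vi power_mult_distrib mult.assoc mult.left_commute)
    thus ?case
      by (simp add: limit_chromatic_def sum_subtractf [symmetric] right_diff_distrib)
  qed
  ultimately show "((\<lambda>(q, z). rescaled_chromatic p q z - limit_chromatic p z) \<longlongrightarrow> 0) ?G"
    by (auto intro: Lim_transform_eventually simp: case_prod_unfold)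
qed

section \<open>Zeros\<close>

text \<open>The rescaling multiplies the polynomial by v^(p+q) exp(p w), which is nonzero because w
  and q are.\<close>

lemma poly_chromatic_poly_eq_0_if_rescaled_chromatic:
  assumes "complete_bipartite_digraph p q G" "q > 0" "scaled_arg q z \<noteq> 0"
    and "rescaled_chromatic p q z = 0"
  shows "poly (chromatic_poly G) (of_nat q / scaled_arg q z) = 0"
proof -
  define w where "w = scaled_arg q z"
  define v where "v = w / of_nat q"
  have v: "v \<noteq> 0" "of_nat q / w = 1 / v" using assms by (auto simp: v_def w_def)
  have "v ^ p * (v ^ q * exp w ^ p) * poly (chromatic_poly G) (1 / v) = rescaled_chromatic p q z"
    unfolding poly_chromatic_poly_complete_bipartite [OF assms(1)] rescaled_chromatic_def Let_def
      w_def [symmetric] v_def [symmetric] sum_distrib_left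
  proof (rule sum.cong [OF refl])
    fix k assume "k \<in> {..p}"
    \<comment> \<open>Of the p factors v, k are absorbed by the falling factorial; of the p factors
      exp w, k form \<open>exp (of_nat k * w)\<close>. The remaining p - k of each pair up.\<close>
    hence pk: "a ^ p = a ^ (p - k) * a ^ k" for a :: complex
      by (simp add: power_add [symmetric])
    have 1: "v * (1 / v - of_nat j) = 1 - of_nat j * v" for j
      using v by (simp add: field_simps)
    have 2: "(\<Prod>j<k. 1 - of_nat j * v) = v ^ k * (\<Prod>j<k. 1 / v - of_nat j)"
      by (simp add: 1 [symmetric] prod.distrib)
    have 3: "(1 - of_nat k * v) ^ q = v ^ q * (1 / v - of_nat k) ^ q"
      by (simp add: 1 [symmetric] power_mult_distrib)
    show "v ^ p * (v ^ q * exp w ^ p) *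
            (of_nat (Stirling p k) * ((\<Prod>j<k. 1 / v - of_nat j) * (1 / v - of_nat k) ^ q)) =
          of_nat (Stirling p k) * ((v * exp w) ^ (p - k) *
            ((\<Prod>j<k. 1 - of_nat j * v) * ((1 - of_nat k * v) ^ q * exp (of_nat k * w))))"
      unfolding 2 3 pk exp_of_nat_mult power_mult_distrib by (simp only: mult_ac)
  qed
  thus ?thesis
    using assms(4) v by (simp add: w_def)
qed

text \<open>A nonzero root of a polynomial in \<open>exp z\<close> is lifted through the logarithm.
  Nonconstancy on every ball is recorded for Hurwitz's theorem.\<close>

lemma ex_nonreal_zero_limit_chromatic:
  assumes "p \<ge> 2"
  shows "\<exists>z. Im z > 0 \<and> limit_chromatic p z = 0 \<and> (\<forall>r>0. \<not> limit_chromatic p constant_on ball z r)"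
proof -
  define Q :: "complex poly" where "Q = (\<Sum>k\<le>p. monom (of_nat (Stirling p k)) (p - k))"
  have limit: "limit_chromatic p z = poly Q (exp z)" for z
    by (simp add: Q_def limit_chromatic_def poly_sum poly_monom)
  obtain m where p: "p = Suc m" and m: "m > 0" using assms by (cases p) auto
  \<comment> \<open>Only k = 1 contributes in degree m = p - 1, with S(p,1) = 1; m > 0 is where p
    \<ge> 2 enters.\<close>
  have "coeff Q m = (\<Sum>k\<le>p. if k = 1 then of_nat (Stirling p k) else 0)"
    unfolding Q_def coeff_sum coeff_monom using p by (intro sum.cong refl) auto
  hence "coeff Q m = 1"
    using m p Stirling_1 [of m] by (simp add: sum.delta del: Stirling.simps)
  hence "degree Q > 0"
    using m le_degree [of Q m] by simp
  hence "Q \<noteq> 0" by auto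
  have "\<not> (\<exists>a l. a \<noteq> 0 \<and> l = 0 \<and> Q = pCons a l)"
    using \<open>degree Q > 0\<close> by auto
  then obtain u where u: "poly Q u = 0"
    using fundamental_theorem_of_algebra_alt by blast
  have "poly Q 0 = (\<Sum>k\<le>p. if k = p then of_nat (Stirling p k) else 0)"
    unfolding Q_def poly_sum poly_monom by (intro sum.cong refl) (auto simp: power_0_left)
  hence "u \<noteq> 0" using u by (auto simp: sum.delta)
  \<comment> \<open>The principal value satisfies \<open>Im (Ln u) > - pi\<close>, so the shift by
    one period makes the imaginary part positive.\<close>
  define z where "z = Ln u + 2 * of_real pi * \<i>"
  have "exp z = u"
    using \<open>u \<noteq> 0\<close> by (simp add: z_def exp_add mult_ac)
  have "\<not> limit_chromatic p constant_on ball z r" if "r > 0" for r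
  proof
    assume "limit_chromatic p constant_on ball z r"
    hence "poly Q (exp y) = 0" if "y \<in> ball z r" for y
      using that \<open>r > 0\<close> u \<open>exp z = u\<close> unfolding constant_on_def limit
      by (metis centre_in_ball)
    \<comment> \<open>Real shifts of \<open>z\<close> give values of \<open>exp\<close> with
      distinct moduli, hence infinitely many roots of \<open>Q\<close>.\<close>
    hence sub: "(\<lambda>t. exp (z + of_real t)) ` {0<..<r} \<subseteq> {x. poly Q x = 0}"
      by (auto simp: dist_norm)
    have "inj_on (\<lambda>t. exp (z + of_real t)) {0<..<r}"
    proof (rule inj_onI)
      fix s t :: real assume "exp (z + of_real s) = exp (z + of_real t)"
      hence "norm (exp (of_real s :: complex)) = norm (exp (of_real t :: complex))"
        by (simp add: exp_add)
      thus "s = t" by simp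
    qed
    moreover have "infinite {0<..<r}"
      using \<open>r > 0\<close> by (simp add: infinite_Ioo)
    ultimately have "infinite ((\<lambda>t. exp (z + of_real t)) ` {0<..<r})"
      using finite_imageD by blast
    thus False
      using finite_subset [OF sub poly_roots_finite [OF \<open>Q \<noteq> 0\<close>]] by blast
  qed
  moreover have "Im z > 0"
  proof -
    have "Im z = Im (Ln u) + 2 * pi" by (simp add: z_def)
    thus ?thesis using mpi_less_Im_Ln [OF \<open>u \<noteq> 0\<close>] pi_gt_zero by linarith
  qed
  moreover have "limit_chromatic p z = 0"
    by (simp add: limit u \<open>exp z = u\<close>)
  ultimately show ?thesis by blast
qed

text \<open>Otherwise some subsequence is zero-free on \<open>S\<close>, and Hurwitz's theorem makes
  its nonconstant limit \<open>g\<close> zero-free too.\<close>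

lemma Hurwitz_eventually_zero:
  assumes S: "open S" "Topological_Spaces.connected S"
    and holf: "\<And>n::nat. f n holomorphic_on S" and holg: "g holomorphic_on S"
    and lim: "\<And>K. compact K \<Longrightarrow> K \<subseteq> S \<Longrightarrow> uniform_limit K f g sequentially"
    and nonconst: "\<not> g constant_on S" and z: "z \<in> S" "g z = 0"
  shows "\<forall>\<^sub>F n in sequentially. \<exists>y\<in>S. f n y = 0"
proof (rule ccontr)
  assume "\<not> ?thesis"
  then obtain r :: "nat \<Rightarrow> nat" where r: "strict_mono r" "\<And>n y. y \<in> S \<Longrightarrow> f (r n) y \<noteq> 0"
    using not_eventually_sequentiallyD by blast
  have "uniform_limit K (\<lambda>n. f (r n)) g sequentially" if "compact K" "K \<subseteq> S" for K
    using filterlim_compose [OF lim [OF that] filterlim_subseq [OF r(1)]] .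
  hence "g z \<noteq> 0"
    by (rule Hurwitz_no_zeros [OF S holf holg _ nonconst r(2) z(1)])
  thus False using z(2) by simp
qed

text \<open>The quotient is (q / ln q) (1 / r) with r = w / ln q \<rightarrow> 1 uniformly.
  Eventually Re (1 / r) > 1/2, while q / ln q exceeds 2 |c|.\<close>

lemma eventually_Re_div_scaled_arg_gt:
  assumes "bounded S"
  shows "\<forall>\<^sub>F q in sequentially. \<forall>z\<in>S. Re (of_nat q / scaled_arg q z) > c"
proof -
  let ?G = "sequentially \<times>\<^sub>F principal S"
  have fst: "filterlim fst sequentially ?G"
    by (rule filterlim_fst)
  have "((\<lambda>i. Re (inverse (case i of (q, z) \<Rightarrow> scaled_arg q z / of_real (ln (real q))))) \<longlongrightarrow>
          Re (inverse 1)) ?G"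
    by (intro tendsto_Re tendsto_inverse scaled_arg_div_ln_tendsto assms) simp
  hence "\<forall>\<^sub>F i in ?G. Re (inverse (case i of (q, z) \<Rightarrow> scaled_arg q z / of_real (ln (real q)))) > 1/2"
    by (rule order_tendstoD) simp
  moreover have "\<forall>\<^sub>F q in sequentially. ln (real q) > 0 \<and> real q / ln (real q) > 2 * \<bar>c\<bar>"
    by (intro eventually_conj) real_asymp+
  hence "\<forall>\<^sub>F i in ?G. ln (real (fst i)) > 0 \<and> real (fst i) / ln (real (fst i)) > 2 * \<bar>c\<bar>"
    by (rule eventually_compose_filterlim [OF _ fst])
  ultimately have "\<forall>\<^sub>F (q, z) in ?G. Re (of_nat q / scaled_arg q z) > c"
  proof eventually_elim
    case (elim i)
    obtain q z where i: "i = (q, z)" by force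
    let ?w = "scaled_arg q z"
    have "of_nat q / ?w = of_real (real q / ln (real q)) * inverse (?w / of_real (ln (real q)))"
      using elim i by (simp add: field_simps)
    hence eq: "Re (of_nat q / ?w) = real q / ln (real q) * Re (inverse (?w / of_real (ln (real q))))"
      by (metis Re_complex_of_real Im_complex_of_real times_complex.simps(1) mult_zero_left diff_zero)
    have "c < real q / ln (real q) * (1/2)"
      using elim i by auto
    also have "\<dots> \<le> real q / ln (real q) * Re (inverse (?w / of_real (ln (real q))))"
      using elim i by (intro mult_left_mono) auto
    finally show ?case
      unfolding i eq [symmetric] by simp
  qed
  thus ?thesis
    by (simp only: eventually_prod_principal)
qed

theorem theorem2p5:
  fixes p :: nat
  assumes "p \<ge> 2"
  shows "\<exists>q0::nat. \<forall>q\<ge>q0. \<forall>G :: ('a, 'b) pre_digraph.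
           complete_bipartite_digraph p q G \<longrightarrow>
           (\<exists>z::complex. poly (chromatic_poly G) z = 0 \<and> z \<notin> \<real> \<and> Re z > real p)"
proof -
  obtain z0 where z0: "Im z0 > 0" "limit_chromatic p z0 = 0"
      "\<not> limit_chromatic p constant_on ball z0 (Im z0)"
    using ex_nonreal_zero_limit_chromatic [OF assms] by blast
  \<comment> \<open>The radius \<open>Im z0\<close> keeps the ball inside the open upper
    half-plane.\<close>
  define S where "S = ball z0 (Im z0)"
  have Im_pos: "Im z > 0" if "z \<in> S" for z
    using that abs_Im_le_cmod [of "z0 - z"] by (auto simp: S_def dist_norm)
  have "\<forall>\<^sub>F q in sequentially. \<exists>z\<in>S. rescaled_chromatic p q z = 0"
  proof (rule Hurwitz_eventually_zero)
    show "open S" "Topological_Spaces.connected S" "\<not> limit_chromatic p constant_on S" "z0 \<in> S"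
      using z0 by (auto simp: S_def)
    show "rescaled_chromatic p q holomorphic_on S" for q
      unfolding rescaled_chromatic_def scaled_arg_def Let_def divide_inverse
      by (intro holomorphic_intros)
    show "limit_chromatic p holomorphic_on S"
      unfolding limit_chromatic_def by (intro holomorphic_intros)
  qed (use z0(2) rescaled_chromatic_uniform_limit compact_imp_bounded in auto)
  moreover have "\<forall>\<^sub>F q in sequentially. \<forall>z\<in>S. Re (of_nat q / scaled_arg q z) > real p"
    by (rule eventually_Re_div_scaled_arg_gt) (simp add: S_def)
  ultimately have "\<forall>\<^sub>F q in sequentially. \<forall>G :: ('a, 'b) pre_digraph.
      complete_bipartite_digraph p q G \<longrightarrow>
      (\<exists>z. poly (chromatic_poly G) z = 0 \<and> z \<notin> \<real> \<and> Re z > real p)"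
    using eventually_gt_at_top [of 0]
  proof eventually_elim
    case (elim q)
    then obtain z where z: "z \<in> S" "rescaled_chromatic p q z = 0" by blast
    let ?w = "scaled_arg q z"
    have "Im ?w > 0" using Im_pos [OF z(1)] by (simp add: scaled_arg_def)
    hence w: "?w \<notin> \<real>" "?w \<noteq> 0" by (auto simp: complex_is_Real_iff)
    \<comment> \<open>Dividing q by this quotient returns w, so a real quotient would make w
      real.\<close>
    have "of_nat q / ?w \<notin> \<real>"
    proof
      assume "of_nat q / ?w \<in> \<real>"
      hence "of_nat q / (of_nat q / ?w) \<in> \<real>" by (rule Reals_divide [OF Reals_of_nat])
      moreover have "of_nat q / (of_nat q / ?w) = ?w" using w elim by simp
      ultimately show False using w by simp
    qed
    thus ?case
      using poly_chromatic_poly_eq_0_if_rescaled_chromatic [OF _ _ w(2) z(2)] elim z(1) by blast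
  qed
  thus ?thesis
    by (simp add: eventually_sequentially)
qed

end
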